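(* Let $d\ge 1$ be an integer (the rank parameter), let $m\geq 2^{7}d$ be a sample size and let $B<\frac{3}{50}d^2$ be a budget. For any budgeted algorithm with budget $B$, there exist a kernel matrix $K\in \mathcal{K}_{2d,m}$ and target values $y_1,\ldots,y_m\in [-1,+1]$ such that the coefficient vector $\boldsymbol{\alpha}\in\mathbb{R}^m$ returned by the algorithm satisfies \[ \left(\frac{1}{m}\sum_{t=1}^{m}\left|\boldsymbol{\alpha}^\top K \boldsymbol{e}_t-y_t\right|\right) -\min_{\boldsymbol{a}\in\mathbb{R}^m\,:\,\boldsymbol{a}^\top K \boldsymbol{a}\leq 2}\ \frac{1}{m}\sum_{t=1}^{m}\left|\boldsymbol{a}^\top K \boldsymbol{e}_t-y_t\right| \;\geq\; \frac{1}{70\sqrt{d}}~. \] (The returned vector $\boldsymbol{\alpha}$ is not required to satisfy $\boldsymbol{\alpha}^\top K\boldsymbol{\alpha}\le 2$.)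
   Context: $\boldsymbol{e}_1,\dots,\boldsymbol{e}_m$ is the standard basis of $\mathbb{R}^m$. Class $\mathcal{K}_{d,m}$: let $\mathcal{K}'_{d,m}$ be the class of all block-diagonal $m\times m$ matrices composed of at most $d$ (square, diagonal) blocks, with all entries equal to $1$ within each block and $0$ outside the blocks. Then $\mathcal{K}_{d,m}$ is the set of $K\in\{0,1\}^{m\times m}$ for which there exist a permutation $\pi$ of $\{1,\dots,m\}$ and $K'\in\mathcal{K}'_{d,m}$ with $K_{i,j}=K'_{\pi(i),\pi(j)}$ for all $i,j$. The class $\mathcal{K}_{2d,m}$ is the one with $2d$ in place of $d$. Budgeted algorithm: the algorithm is given the target values $y_1,\dots,y_m$ but not the kernel matrix $K$. It may (adaptively) query at most $B$ entries of $K$, and then returns a coefficient vector $\boldsymbol{\alpha}\in\mathbb{R}^m$ based on this information. If the algorithm is randomized, the error of the returned vector is understood in expectation over the algorithm's internal randomness. *)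

theory Defs
  imports "HOL-Probability.Probability" "Jordan_Normal_Form.Matrix"
begin

unbundle no inner_syntax
unbundle no vec_syntax

text \<open>Indices run over \<open>0, \<dots>, m - 1\<close> instead of \<open>1, \<dots>, m\<close>.\<close>

definition block_kernels :: "nat \<Rightarrow> nat \<Rightarrow> real mat set" where
  "block_kernels d m =
    {diag_block_mat (map (\<lambda>n. mat n n (\<lambda>_. 1)) ns) | ns.
       length ns \<le> d \<and> (\<forall>n\<in>set ns. 0 < n) \<and> sum_list ns = m}"

definition kernel_class :: "nat \<Rightarrow> nat \<Rightarrow> real mat set" where
  "kernel_class d m =
    {K \<in> carrier_mat m m. (\<forall>i<m. \<forall>j<m. K $$ (i, j) \<in> {0, 1}) \<and>
       (\<exists>\<pi> K'. \<pi> permutes {..<m} \<and> K' \<in> block_kernels d m \<and>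
          (\<forall>i<m. \<forall>j<m. K $$ (i, j) = K' $$ (\<pi> i, \<pi> j)))}"

definition targets :: "nat \<Rightarrow> real vec set" where
  "targets m = {y \<in> carrier_vec m. \<forall>t<m. y $ t \<in> {-1..1}}"

definition avg_loss :: "nat \<Rightarrow> real mat \<Rightarrow> real vec \<Rightarrow> real vec \<Rightarrow> real" where
  "avg_loss m K y a = 1 / real m * (\<Sum>t<m. \<bar>a \<bullet> (K *\<^sub>v unit_vec m t) - y $ t\<bar>)"

text \<open>The infimum over the feasible set is a minimum; see \<open>min_loss_attained\<close> below.\<close>

definition feasible :: "nat \<Rightarrow> real mat \<Rightarrow> real vec set" where
  "feasible m K = {a \<in> carrier_vec m. a \<bullet> (K *\<^sub>v a) \<le> 2}"

definition min_loss :: "nat \<Rightarrow> real mat \<Rightarrow> real vec \<Rightarrow> real" where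
  "min_loss m K y = (INF a\<in>feasible m K. avg_loss m K y a)"

text \<open>
  A strategy is the decision tree of an adaptive procedure: it either stops and returns a coefficient
  vector, or queries one entry of the kernel matrix and continues depending on the answer. The
  matrix is accessible through the answers only.
\<close>

datatype strategy = Return "real vec" | Query nat nat "real \<Rightarrow> strategy"

primrec returned :: "strategy \<Rightarrow> real mat \<Rightarrow> real vec" where
  "returned (Return a) K = a"
| "returned (Query i j c) K = returned (c (K $$ (i, j))) K"

primrec queried :: "strategy \<Rightarrow> real mat \<Rightarrow> (nat \<times> nat) set" where
  "queried (Return a) K = {}"
| "queried (Query i j c) K = insert (i, j) (queried (c (K $$ (i, j))) K)"

text \<open>
  Repeated queries of the same entry are counted once, and an algorithm only has to respect the
  budget on the admissible inputs: kernel matrices in \<open>\<K>\<close> and targets in \<open>[-1, 1]\<close>.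
\<close>

definition budgeted :: "real mat set \<Rightarrow> nat \<Rightarrow> nat \<Rightarrow> (real vec \<Rightarrow> strategy) \<Rightarrow> bool" where
  "budgeted \<K> m B S \<longleftrightarrow>
    (\<forall>y\<in>targets m. \<forall>K\<in>\<K>.
       queried (S y) K \<subseteq> {..<m} \<times> {..<m} \<and> card (queried (S y) K) \<le> B \<and>
       returned (S y) K \<in> carrier_vec m)"

text \<open>
  A randomized algorithm draws its internal randomness \<open>\<omega>\<close> from \<open>M\<close> and then runs the deterministic
  algorithm \<open>A \<omega>\<close>. On every admissible input the returned vector is a random vector. Deterministic
  algorithms are the case of a one-point space \<open>M\<close>.
\<close>

definition budgeted_algorithm ::
  "real mat set \<Rightarrow> nat \<Rightarrow> nat \<Rightarrow> 'w measure \<Rightarrow> ('w \<Rightarrow> real vec \<Rightarrow> strategy) \<Rightarrow> bool" where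
  "budgeted_algorithm \<K> m B M A \<longleftrightarrow>
    prob_space M \<and> (\<forall>\<omega>\<in>space M. budgeted \<K> m B (A \<omega>)) \<and>
    (\<forall>y\<in>targets m. \<forall>K\<in>\<K>. \<forall>i<m. (\<lambda>\<omega>. returned (A \<omega> y) K $ i) \<in> borel_measurable M)"

text \<open>The expectation is extended-valued, because the loss of the returned vector need not be integrable.\<close>

definition expected_loss ::
  "nat \<Rightarrow> 'w measure \<Rightarrow> ('w \<Rightarrow> real vec \<Rightarrow> strategy) \<Rightarrow> real mat \<Rightarrow> real vec \<Rightarrow> ereal" where
  "expected_loss m M A K y =
    enn2ereal (\<integral>\<^sup>+\<omega>. ennreal (avg_loss m K y (returned (A \<omega> y) K)) \<partial>M)"

lemma avg_loss_nonneg: "0 \<le> avg_loss m K y a"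
  by (simp add: avg_loss_def sum_nonneg)

lemma budgeted_algorithm_deterministic:
  assumes "budgeted \<K> m B S"
  shows "budgeted_algorithm \<K> m B (return (count_space UNIV) ()) (\<lambda>_. S)"
    and "expected_loss m (return (count_space UNIV) ()) (\<lambda>_. S) K y =
           ereal (avg_loss m K y (returned (S y) K))"
  using assms
  by (auto simp: budgeted_algorithm_def expected_loss_def prob_space_return
      nn_integral_return avg_loss_nonneg)

lemma diag_block_mat_ones:
  "\<exists>g :: nat \<Rightarrow> nat. (\<forall>i<sum_list ns. g i < length ns) \<and>
     (\<forall>i<sum_list ns. \<forall>j<sum_list ns.
       diag_block_mat (map (\<lambda>n. mat n n (\<lambda>_. 1 :: real)) ns) $$ (i, j) = (if g i = g j then 1 else 0))"
proof (induction ns)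
  case (Cons n ns)
  let ?D = "\<lambda>ns. diag_block_mat (map (\<lambda>n. mat n n (\<lambda>_. 1 :: real)) ns)"
  obtain g :: "nat \<Rightarrow> nat" where
    g: "\<forall>i<sum_list ns. g i < length ns"
       "\<forall>i<sum_list ns. \<forall>j<sum_list ns. ?D ns $$ (i, j) = (if g i = g j then 1 else 0)"
    using Cons.IH by blast
  have dim: "dim_row (?D ns) = sum_list ns" "dim_col (?D ns) = sum_list ns"
    by (simp_all add: dim_diag_block_mat comp_def)
  define h where "h i = (if i < n then 0 else Suc (g (i - n)))" for i
  have "h i < length (n # ns)" if "i < sum_list (n # ns)" for i
    using g(1) that by (auto simp: h_def)
  moreover have "?D (n # ns) $$ (i, j) = (if h i = h j then 1 else 0)"
    if "i < sum_list (n # ns)" "j < sum_list (n # ns)" for i j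
    using g(2) that by (auto simp: h_def dim Let_def)
  ultimately show ?case by blast
qed simp

lemma kernel_class_labels:
  assumes "K \<in> kernel_class d m"
  obtains g :: "nat \<Rightarrow> nat" where "\<And>i. i < m \<Longrightarrow> g i < d"
    "\<And>i j. i < m \<Longrightarrow> j < m \<Longrightarrow> K $$ (i, j) = (if g i = g j then 1 else 0)"
proof -
  obtain \<pi> ns where p: "\<pi> permutes {..<m}" and ns: "length ns \<le> d" "sum_list ns = m"
    and K: "\<forall>i<m. \<forall>j<m. K $$ (i, j) =
              diag_block_mat (map (\<lambda>n. mat n n (\<lambda>_. 1)) ns) $$ (\<pi> i, \<pi> j)"
    using assms unfolding kernel_class_def block_kernels_def by blast
  obtain g :: "nat \<Rightarrow> nat" where g: "\<forall>i<m. g i < length ns"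
    "\<forall>i<m. \<forall>j<m. diag_block_mat (map (\<lambda>n. mat n n (\<lambda>_. 1 :: real)) ns) $$ (i, j) =
       (if g i = g j then 1 else 0)"
    using diag_block_mat_ones[of ns] ns by auto
  have "\<pi> i < m" if "i < m" for i
    using permutes_in_image[OF p, of i] that by simp
  then show ?thesis
    using g K ns by (intro that[of "g \<circ> \<pi>"]) (auto intro: less_le_trans)
qed

lemma avg_loss_eq:
  assumes "K \<in> carrier_mat m m" "a \<in> carrier_vec m"
  shows "avg_loss m K y a = 1 / real m * (\<Sum>t<m. \<bar>(\<Sum>i<m. a $ i * K $$ (i, t)) - y $ t\<bar>)"
proof -
  have "a \<bullet> (K *\<^sub>v unit_vec m t) = (\<Sum>i<m. a $ i * K $$ (i, t))" if "t < m" for t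
    using assms that
    by (auto simp: scalar_prod_def atLeast0LessThan if_distrib cong: if_cong
        intro!: sum.cong)
  then show ?thesis by (simp add: avg_loss_def)
qed

lemma quadratic_form_eq:
  fixes a :: "real vec"
  assumes "K \<in> carrier_mat m m" "a \<in> carrier_vec m"
  shows "a \<bullet> (K *\<^sub>v a) = (\<Sum>i<m. a $ i * (\<Sum>j<m. K $$ (i, j) * a $ j))"
  using assms by (auto simp: scalar_prod_def atLeast0LessThan intro!: sum.cong)

text \<open>
  A vector enters the loss and the constraint only through its predictions \<open>p = K a\<close>, which range
  over a compact set.
\<close>

lemma min_loss_attained:
  assumes K: "K \<in> kernel_class d m"
  shows "\<exists>a\<in>feasible m K. avg_loss m K y a = min_loss m K y \<and>
    (\<forall>b\<in>feasible m K. avg_loss m K y a \<le> avg_loss m K y b)"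
proof -
  have Km: "K \<in> carrier_mat m m" using K by (simp add: kernel_class_def)
  obtain g :: "nat \<Rightarrow> nat" where
    g: "\<And>i j. i < m \<Longrightarrow> j < m \<Longrightarrow> K $$ (i, j) = (if g i = g j then 1 else 0)"
    using kernel_class_labels[OF K] by metis
  define n where "n i = (\<Sum>j<m. K $$ (i, j))" for i
  have sym: "K $$ (i, j) = K $$ (j, i)" if "i < m" "j < m" for i j
    using g that by simp
  have n1: "n i \<ge> 1" if "i < m" for i
  proof -
    have "K $$ (i, i) \<le> n i"
      unfolding n_def using that g by (intro member_le_sum) auto
    then show ?thesis using g that by simp
  qed
  have nm: "n i \<le> m" if "i < m" for i
  proof -
    have "n i \<le> (\<Sum>j<m. 1)"
      unfolding n_def using that g by (intro sum_mono) auto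
    then show ?thesis by simp
  qed
  have n_eq: "n i = n j" if "i < m" "j < m" "g i = g j" for i j
    unfolding n_def using that g by (intro sum.cong) auto
  define C where "C = {p :: nat \<Rightarrow> real. (\<Sum>i<m. (p i)\<^sup>2 / n i) \<le> 2 \<and>
     (\<forall>i<m. \<forall>j<m. g i = g j \<longrightarrow> p i = p j) \<and> (\<forall>i. i \<ge> m \<longrightarrow> p i = 0)}"
  define L where "L p = 1 / real m * (\<Sum>t<m. \<bar>p t - y $ t\<bar>)" for p :: "nat \<Rightarrow> real"
  have cont: "continuous_on UNIV (\<lambda>p :: nat \<Rightarrow> real. p i)" for i
    by (rule continuous_on_product_coordinates)
  have "closed {p :: nat \<Rightarrow> real. (\<Sum>i<m. (p i)\<^sup>2 / n i) \<le> 2}"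
  proof (rule closed_Collect_le)
    show "continuous_on UNIV (\<lambda>p :: nat \<Rightarrow> real. \<Sum>i<m. (p i)\<^sup>2 / n i)"
    proof (rule continuous_on_sum)
      fix i assume "i \<in> {..<m}"
      then have "n i \<noteq> 0" using n1[of i] by auto
      then show "continuous_on UNIV (\<lambda>p :: nat \<Rightarrow> real. (p i)\<^sup>2 / n i)"
        by (intro continuous_on_divide continuous_on_power cont continuous_on_const) simp
    qed
  qed simp
  moreover have "closed {p :: nat \<Rightarrow> real. \<forall>i<m. \<forall>j<m. g i = g j \<longrightarrow> p i = p j}"
    by (intro closed_Collect_all closed_Collect_imp closed_Collect_eq cont) simp_all
  moreover have "closed {p :: nat \<Rightarrow> real. \<forall>i. i \<ge> m \<longrightarrow> p i = 0}"
    by (intro closed_Collect_all closed_Collect_imp closed_Collect_eq cont) simp_all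
  ultimately have "closed C"
    unfolding C_def by (intro closed_Collect_conj)
  define R where "R = 2 * real m + 2"
  have box: "compact (PiE UNIV (\<lambda>_ :: nat. {-R..R}))"
    using compactin_PiE[of "\<lambda>_. euclidean" UNIV "\<lambda>_ :: nat. {-R..R}"]
    by (simp add: euclidean_product_topology)
  have C1: "(\<Sum>i<m. (p i)\<^sup>2 / n i) \<le> 2"
    and C2: "\<And>i j. i < m \<Longrightarrow> j < m \<Longrightarrow> g i = g j \<Longrightarrow> p i = p j"
    and C3: "\<And>i. i \<ge> m \<Longrightarrow> p i = 0" if "p \<in> C" for p
    using that unfolding C_def by blast+
  have "\<bar>p i\<bar> \<le> R" if p: "p \<in> C" for p i
  proof (cases "i < m")
    case True
    have "(p i)\<^sup>2 / n i \<le> (\<Sum>i<m. (p i)\<^sup>2 / n i)"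
      using True n1 by (intro member_le_sum) (auto intro!: divide_nonneg_nonneg dest: order_trans[OF zero_le_one])
    also have "\<dots> \<le> 2" by (rule C1[OF p])
    finally have "(p i)\<^sup>2 \<le> 2 * n i" using n1[OF True] by (simp add: divide_simps)
    also have "\<dots> \<le> 2 * real m" using nm[OF True] by simp
    also have "\<dots> \<le> (R)\<^sup>2" by (simp add: R_def power2_eq_square algebra_simps)
    finally show ?thesis using abs_le_square_iff[of "p i" R] by (simp add: R_def)
  next
    case False
    then show ?thesis using C3[OF p, of i] by (simp add: R_def)
  qed
  then have "C \<subseteq> PiE UNIV (\<lambda>_ :: nat. {-R..R})"
    by (auto simp: abs_le_iff minus_le_iff)
  then have "compact C"
    using compact_Int_closed[OF box \<open>closed C\<close>] by (simp add: Int_absorb1)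
  moreover have "(\<lambda>_. 0) \<in> C" by (simp add: C_def)
  moreover have "continuous_on C L"
    unfolding L_def
    by (intro continuous_on_mult continuous_on_const continuous_on_sum continuous_on_rabs
        continuous_on_diff continuous_on_subset[OF cont subset_UNIV])
  ultimately obtain p where p: "p \<in> C" and p_min: "\<And>q. q \<in> C \<Longrightarrow> L p \<le> L q"
    using continuous_attains_inf[of C L] by auto
  define a where "a = vec m (\<lambda>i. p i / n i)"
  have a_pred: "(\<Sum>j<m. K $$ (i, j) * a $ j) = p i" if i: "i < m" for i
  proof -
    have "(\<Sum>j<m. K $$ (i, j) * a $ j) = (\<Sum>j<m. K $$ (i, j) * (p i / n i))"
    proof (intro sum.cong refl)
      fix j assume j: "j \<in> {..<m}"
      show "K $$ (i, j) * a $ j = K $$ (i, j) * (p i / n i)"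
        using j g[of i j] n_eq[of i j] C2[OF p, of i j] i by (auto simp: a_def)
    qed
    also have "\<dots> = n i * (p i / n i)" unfolding n_def by (rule sum_distrib_right[symmetric])
    also have "\<dots> = p i" using n1[OF i] by simp
    finally show ?thesis .
  qed
  have am: "a \<in> carrier_vec m" by (simp add: a_def)
  have "a \<bullet> (K *\<^sub>v a) = (\<Sum>i<m. (p i)\<^sup>2 / n i)"
    by (simp add: quadratic_form_eq[OF Km am] a_pred) (simp add: a_def power2_eq_square)
  then have a_feas: "a \<in> feasible m K" using C1[OF p] am by (simp add: feasible_def)
  have loss_pred: "avg_loss m K y b = L (\<lambda>i. if i < m then \<Sum>j<m. K $$ (i, j) * b $ j else 0)"
    if b: "b \<in> carrier_vec m" for b
  proof -
    have "(\<Sum>i<m. b $ i * K $$ (i, t)) = (\<Sum>j<m. K $$ (t, j) * b $ j)" if "t < m" for t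
      using that sym by (intro sum.cong) auto
    then show ?thesis by (simp add: avg_loss_eq[OF Km b] L_def)
  qed
  have a_loss: "avg_loss m K y a = L p"
    using a_pred by (simp add: loss_pred[OF am] L_def)
  have opt: "avg_loss m K y a \<le> avg_loss m K y b" if b: "b \<in> feasible m K" for b
  proof -
    have bm: "b \<in> carrier_vec m" and b2: "b \<bullet> (K *\<^sub>v b) \<le> 2"
      using b by (auto simp: feasible_def)
    define q where "q i = (if i < m then \<Sum>j<m. K $$ (i, j) * b $ j else 0)" for i
    have q_eq: "q i = q j" if "i < m" "j < m" "g i = g j" for i j
      using that(1,2) unfolding q_def by (auto simp: g that(3) intro!: sum.cong)
    have "(\<Sum>i<m. (q i)\<^sup>2 / n i) = (\<Sum>i<m. \<Sum>j<m. K $$ (i, j) * b $ j * (q i / n i))"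
    proof (intro sum.cong refl)
      fix i assume "i \<in> {..<m}"
      then have "(q i)\<^sup>2 / n i = (\<Sum>j<m. K $$ (i, j) * b $ j) * (q i / n i)"
        by (simp add: q_def power2_eq_square)
      then show "(q i)\<^sup>2 / n i = (\<Sum>j<m. K $$ (i, j) * b $ j * (q i / n i))"
        by (simp only: sum_distrib_right)
    qed
    also have "\<dots> = (\<Sum>j<m. \<Sum>i<m. K $$ (i, j) * b $ j * (q i / n i))"
      by (rule sum.swap)
    also have "\<dots> = (\<Sum>j<m. b $ j * q j)"
    proof (intro sum.cong refl)
      fix j assume j: "j \<in> {..<m}"
      have "(\<Sum>i<m. K $$ (i, j) * b $ j * (q i / n i)) = (\<Sum>i<m. K $$ (j, i) * (b $ j * (q j / n j)))"
      proof (intro sum.cong refl)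
        fix i assume i: "i \<in> {..<m}"
        show "K $$ (i, j) * b $ j * (q i / n i) = K $$ (j, i) * (b $ j * (q j / n j))"
          using i j g[of i j] g[of j i] n_eq[of i j] q_eq[of i j] by auto
      qed
      also have "\<dots> = n j * (b $ j * (q j / n j))"
        unfolding n_def by (rule sum_distrib_right[symmetric])
      also have "\<dots> = b $ j * q j" using n1[of j] j by simp
      finally show "(\<Sum>i<m. K $$ (i, j) * b $ j * (q i / n i)) = b $ j * q j" .
    qed
    also have "\<dots> = b \<bullet> (K *\<^sub>v b)"
      by (simp add: quadratic_form_eq[OF Km bm] q_def)
    finally have "(\<Sum>i<m. (q i)\<^sup>2 / n i) \<le> 2" using b2 by simp
    moreover have "q i = 0" if "i \<ge> m" for i using that by (simp add: q_def)
    ultimately have "q \<in> C" unfolding C_def using q_eq by blast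
    then show ?thesis using p_min a_loss loss_pred[OF bm] by (simp add: q_def[abs_def])
  qed
  have "avg_loss m K y a = min_loss m K y"
    unfolding min_loss_def
    by (rule cInf_eq_minimum[symmetric]) (use a_feas opt in auto)
  then show ?thesis using a_feas opt by blast
qed

end

theory Submission
  imports Defs
begin

text \<open>
  Split the indices into \<open>2 d\<close> known groups and let all targets equal \<open>c = 1 / sqrt d\<close>. Each of the
  last \<open>d\<close> groups is, independently and uniformly, either left alone or merged with one of the first
  \<open>d\<close> groups. The comparator has loss \<open>0\<close> for every outcome. If an algorithm gives weight \<open>w\<close> to the
  group \<open>i\<close> when it is alone and weight \<open>v\<close> to the block of the group \<open>j\<close>, then it returns the same
  vector when \<open>i\<close> is merged with that block, unless one of its queries links the two. Since
  \<open>\<bar>w - c\<bar> + \<bar>v - c\<bar> + \<bar>v + w - c\<bar> \<ge> c\<close>, it errs by a constant fraction of \<open>c\<close> on average over the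
  undetected pairs \<open>(i, j)\<close>, and with \<open>B\<close> queries only a small part of the \<open>d\<^sup>2\<close> pairs is detected.
  Averaging over the merges handles randomized algorithms.
\<close>

section \<open>Strategies, and kernels given by a labelling of the indices\<close>

text \<open>Both runs follow the same path of the decision tree, since every answer along it
  agrees.\<close>

lemma returned_eq_if_agree_on_queried:
  assumes "\<And>i j. (i, j) \<in> queried S K \<Longrightarrow> K' $$ (i, j) = K $$ (i, j)"
  shows "returned S K' = returned S K"
  using assms by (induction S) auto

definition label_kernel :: "nat \<Rightarrow> (nat \<Rightarrow> 'l) \<Rightarrow> real mat" where
  "label_kernel m f = mat m m (\<lambda>(s, t). if f s = f t then 1 else 0)"

lemma label_kernel_carrier [simp]: "label_kernel m f \<in> carrier_mat m m"
  by (simp add: label_kernel_def)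

lemma label_kernel_index [simp]:
  "s < m \<Longrightarrow> t < m \<Longrightarrow> label_kernel m f $$ (s, t) = (if f s = f t then 1 else 0)"
  by (simp add: label_kernel_def)

text \<open>Listing the elements label by label turns every label class into an interval of
  positions. The induction splits off the first interval; as \<open>ls\<close> is distinct, its
  label does not recur later.\<close>

lemma diag_block_mat_ones_sorted_by_label:
  fixes f :: "'a \<Rightarrow> 'l"
  defines "fib \<equiv> \<lambda>xs l. filter (\<lambda>x. f x = l) xs"
  assumes "distinct ls"
    and "k < length (concat (map (fib xs) ls))" "k' < length (concat (map (fib xs) ls))"
  shows "diag_block_mat (map (\<lambda>l. mat (length (fib xs l)) (length (fib xs l)) (\<lambda>_. 1 :: real)) ls) $$ (k, k') =
    (if f (concat (map (fib xs) ls) ! k) = f (concat (map (fib xs) ls) ! k') then 1 else 0)"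
  using assms(2-)
proof (induction ls arbitrary: k k')
  case (Cons l ls)
  let ?c = "\<lambda>ls. concat (map (fib xs) ls)"
  let ?D = "diag_block_mat (map (\<lambda>l. mat (length (fib xs l)) (length (fib xs l)) (\<lambda>_. 1 :: real)) ls)"
  let ?n = "length (fib xs l)"
  have dim: "dim_row ?D = length (?c ls)" "dim_col ?D = length (?c ls)"
    by (simp_all add: dim_diag_block_mat comp_def length_concat)
  have hd: "f (fib xs l ! a) = l" if "a < ?n" for a
    using nth_mem[OF that] by (simp add: fib_def)
  have tl: "f (?c ls ! a) \<noteq> l" if "a < length (?c ls)" for a
    using nth_mem[OF that] Cons.prems(1) by (auto simp: fib_def)
  have IH: "?D $$ (a, a') = (if f (?c ls ! a) = f (?c ls ! a') then 1 else 0)"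
    if "a < length (?c ls)" "a' < length (?c ls)" for a a'
    using Cons.IH[of a a'] Cons.prems(1) that by simp
  have len: "k - ?n < length (?c ls)" if "?n \<le> k" "k < length (?c (l # ls))" for k
    using that by auto
  consider "k < ?n" "k' < ?n" | "k < ?n" "k' \<ge> ?n" | "k \<ge> ?n" "k' < ?n" | "k \<ge> ?n" "k' \<ge> ?n"
    by linarith
  then show ?case
    using Cons.prems(2,3) hd tl[of "k - ?n"] tl[of "k' - ?n"] IH[of "k - ?n" "k' - ?n"] len
    by cases (auto simp: nth_append dim Let_def)
qed simp

text \<open>Sorting the indices by label makes the kernel block-diagonal; \<open>\<pi>\<close> sends
  an index to its position in the sorted list \<open>xs\<close>. Only labels that occur enter
  \<open>ls\<close>, so no block is empty.\<close>

lemma label_kernel_in_kernel_class: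
  fixes f :: "nat \<Rightarrow> nat"
  assumes "f ` {..<m} \<subseteq> L" "finite L" "card L \<le> d"
  shows "label_kernel m f \<in> kernel_class d m"
proof -
  define fib where "fib l = filter (\<lambda>x. f x = l) [0..<m]" for l
  define ls where "ls = sorted_list_of_set (f ` {..<m})"
  define xs where "xs = concat (map fib ls)"
  define ns where "ns = map (length \<circ> fib) ls"
  have ls: "distinct ls" "set ls = f ` {..<m}" by (simp_all add: ls_def)
  have "distinct xs"
    unfolding xs_def using ls
    by (intro distinct_concat)
      (auto simp: fib_def distinct_map inj_on_def filter_empty_conv dest!: arg_cong[where f = set])
  have "set xs = {..<m}" using ls by (auto simp: xs_def fib_def)
  then have "length xs = m" using distinct_card[OF \<open>distinct xs\<close>] by simp
  have "length ns \<le> d"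
    using card_mono[OF assms(2,1)] assms(3) by (simp add: ns_def ls_def)
  moreover have "\<forall>n\<in>set ns. 0 < n"
    using ls by (auto simp: ns_def fib_def filter_empty_conv)
  moreover have "sum_list ns = m"
    using \<open>length xs = m\<close> by (simp add: xs_def ns_def length_concat comp_def)
  ultimately have block: "diag_block_mat (map (\<lambda>n. mat n n (\<lambda>_. 1)) ns) \<in> block_kernels d m"
    (is "?K' \<in> _")
    unfolding block_kernels_def by (intro CollectI exI[of _ ns] conjI refl)
  have nth: "bij_betw ((!) xs) {..<m} {..<m}"
    by (rule bij_betw_nth) (simp_all only: \<open>distinct xs\<close> \<open>set xs = _\<close> \<open>length xs = m\<close>)
  define \<pi> where "\<pi> t = (if t < m then inv_into {..<m} ((!) xs) t else t)" for t
  have "bij_betw \<pi> {..<m} {..<m}"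
    by (rule bij_betw_cong[THEN iffD2, OF _ bij_betw_inv_into[OF nth]]) (simp add: \<pi>_def)
  then have perm: "\<pi> permutes {..<m}"
    by (intro bij_imp_permutes) (simp_all add: \<pi>_def)
  have \<pi>: "\<pi> t < m" "xs ! \<pi> t = t" if "t < m" for t
    using that permutes_in_image[OF perm, of t] bij_betw_inv_into_right[OF nth, of t]
    by (simp_all add: \<pi>_def)
  have "label_kernel m f $$ (s, t) = ?K' $$ (\<pi> s, \<pi> t)" if "s < m" "t < m" for s t
    using diag_block_mat_ones_sorted_by_label[OF ls(1), of "\<pi> s" f "[0..<m]" "\<pi> t",
        folded fib_def, folded xs_def] \<pi> that \<open>length xs = m\<close>
    by (simp add: ns_def comp_def)
  moreover have "label_kernel m f $$ (s, t) \<in> {0, 1}" if "s < m" "t < m" for s t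
    using that by simp
  ultimately show ?thesis
    unfolding kernel_class_def using perm block label_kernel_carrier[of m f] by blast
qed

text \<open>The value that \<open>a\<close> predicts at every index with label \<open>l\<close>
  under \<open>label_kernel m f\<close>.\<close>

definition block_sum :: "nat \<Rightarrow> (nat \<Rightarrow> 'l) \<Rightarrow> real vec \<Rightarrow> 'l \<Rightarrow> real" where
  "block_sum m f a l = (\<Sum>s | s < m \<and> f s = l. a $ s)"

lemma avg_loss_label_kernel:
  assumes "a \<in> carrier_vec m"
  shows "avg_loss m (label_kernel m f) y a =
    1 / real m * (\<Sum>t<m. \<bar>block_sum m f a (f t) - y $ t\<bar>)"
proof -
  have "(\<Sum>i<m. a $ i * label_kernel m f $$ (i, t)) = block_sum m f a (f t)" if "t < m" for t
  proof -
    have "(\<Sum>i<m. a $ i * label_kernel m f $$ (i, t)) = (\<Sum>i<m. if f i = f t then a $ i else 0)"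
      using that by (intro sum.cong) auto
    also have "\<dots> = block_sum m f a (f t)"
      unfolding block_sum_def by (subst sum.inter_filter[symmetric]) (auto intro!: sum.cong)
    finally show ?thesis .
  qed
  then show ?thesis using assms by (simp add: avg_loss_eq)
qed

lemma min_loss_le_avg_loss:
  assumes "a \<in> feasible m K"
  shows "min_loss m K y \<le> avg_loss m K y a"
  unfolding min_loss_def using assms
  by (intro cINF_lower bdd_belowI[of _ 0]) (auto simp: avg_loss_nonneg)

section \<open>Resampling and counting\<close>

text \<open>Resampling one coordinate of a uniform \<open>g\<close> keeps it uniform: exchanging
  \<open>g i\<close> and \<open>x\<close> is an involution on the pairs
  \<open>(g, x)\<close>.\<close>

lemma sum_PiE_update:
  fixes F :: "('a \<Rightarrow> 'b) \<Rightarrow> real"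
  assumes "i \<in> I"
  shows "(\<Sum>g\<in>PiE I (\<lambda>_. X). \<Sum>x\<in>X. F (g(i := x))) = real (card X) * (\<Sum>g\<in>PiE I (\<lambda>_. X). F g)"
proof -
  let ?G = "PiE I (\<lambda>_. X)"
  have "(\<Sum>g\<in>?G. \<Sum>x\<in>X. F (g(i := x))) = (\<Sum>(g, x)\<in>?G \<times> X. F (g(i := x)))"
    by (rule sum.cartesian_product)
  also have "\<dots> = (\<Sum>(g, x)\<in>?G \<times> X. F g)"
    using assms
    by (intro sum.reindex_bij_witness[where i = "\<lambda>(g, x). (g(i := x), g i)"
          and j = "\<lambda>(g, x). (g(i := x), g i)"])
      (auto simp: PiE_iff extensional_def)
  also have "\<dots> = (\<Sum>g\<in>?G. \<Sum>x\<in>X. F g)"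
    by (rule sum.cartesian_product[symmetric])
  finally show ?thesis by (simp add: sum_distrib_left)
qed

lemma sum_card_fibres_le:
  assumes "finite I" "finite Q"
  shows "(\<Sum>i\<in>I. card {p \<in> Q. h p = i}) \<le> card Q"
proof -
  have "(\<Sum>i\<in>I. card {p \<in> Q. h p = i}) = card (\<Union>i\<in>I. {p \<in> Q. h p = i})"
    using assms by (intro card_UN_disjoint[symmetric]) auto
  also have "\<dots> \<le> card Q" using assms by (intro card_mono) auto
  finally show ?thesis .
qed

section \<open>Random merging of the groups\<close>

text \<open>
  Groups are the residue classes modulo \<open>2 d\<close>. Any value \<open>g b \<ge> d\<close> encodes that the group \<open>b\<close> is left
  alone, so that a uniform \<open>g\<close> merges each of the last \<open>d\<close> groups with probability \<open>1 / 2\<close>.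
\<close>

definition attach :: "nat \<Rightarrow> (nat \<Rightarrow> nat) \<Rightarrow> nat \<Rightarrow> nat" where
  "attach d g b = (if d \<le> b \<and> g b < d then g b else b)"

definition attach_label :: "nat \<Rightarrow> (nat \<Rightarrow> nat) \<Rightarrow> nat \<Rightarrow> nat" where
  "attach_label d g t = attach d g (t mod (2 * d))"

lemma attach_less: "b < 2 * d \<Longrightarrow> attach d g b < 2 * d"
  by (auto simp: attach_def)

lemma attach_idem [simp]: "attach d g (attach d g b) = attach d g b"
  by (auto simp: attach_def)

lemma attach_update_alone: "d \<le> x \<Longrightarrow> attach d (g(i := x)) = attach d (g(i := d))"
  by (auto simp: attach_def fun_eq_iff)

text \<open>Nothing is ever attached to a group \<open>i \<ge> d\<close>. When alone it is therefore
  exactly one residue class, and merging it relabels that class only.\<close>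

lemma attach_label_update:
  assumes "d \<le> i"
  shows "attach_label d (g(i := d)) t = i \<longleftrightarrow> t mod (2 * d) = i"
    and "j < d \<Longrightarrow> attach_label d (g(i := j)) t =
      (if t mod (2 * d) = i then j else attach_label d (g(i := d)) t)"
  using assms by (auto simp: attach_label_def attach_def)

lemma block_sum_attach:
  assumes "d \<le> i" "j < d"
  shows "block_sum m (attach_label d (g(i := j))) a j =
    block_sum m (attach_label d (g(i := d))) a i + block_sum m (attach_label d (g(i := d))) a j"
proof -
  let ?A = "\<lambda>l. {s. s < m \<and> attach_label d (g(i := d)) s = l}"
  have "{s. s < m \<and> attach_label d (g(i := j)) s = j} = ?A i \<union> ?A j"
    using attach_label_update[OF assms(1)] assms(2) by auto
  moreover have "?A i \<inter> ?A j = {}"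
  proof -
    have "{s. s < m \<and> h s = i} \<inter> {s. s < m \<and> h s = j} = {}" for h :: "nat \<Rightarrow> nat"
      using assms by auto
    then show ?thesis .
  qed
  then have "sum (($) a) (?A i \<union> ?A j) = sum (($) a) (?A i) + sum (($) a) (?A j)"
    by (intro sum.union_disjoint) simp_all
  ultimately show ?thesis unfolding block_sum_def by (simp only:)
qed

lemma attach_kernel_in_kernel_class:
  assumes "d \<ge> 1"
  shows "label_kernel m (attach_label d g) \<in> kernel_class (2 * d) m"
  using assms by (intro label_kernel_in_kernel_class[of _ _ "{..<2 * d}"])
    (auto simp: attach_label_def intro!: attach_less)

text \<open>The comparator puts \<open>?c\<close> on one representative per block, the index below
  \<open>2 * d\<close> that equals the label of the block. All predictions are then
  \<open>?c\<close>, and the quadratic form is \<open>?c\<^sup>2\<close> times the number of blocks,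
  at most \<open>2 * d * ?c\<^sup>2 = 2\<close>. This is where the value of \<open>?c\<close> comes
  from.\<close>

lemma min_loss_attach_kernel_le_0:
  assumes "d \<ge> 1" "2 * d \<le> m"
  shows "min_loss m (label_kernel m (attach_label d g)) (vec m (\<lambda>_. 1 / sqrt (real d))) \<le> 0"
proof -
  let ?c = "1 / sqrt (real d)" and ?f = "attach_label d g"
  let ?K = "label_kernel m ?f"
  define a where "a = vec m (\<lambda>s. if s < 2 * d \<and> attach d g s = s then ?c else 0)"
  have am: "a \<in> carrier_vec m" by (simp add: a_def)
  have f: "?f t < 2 * d" "attach d g (?f t) = ?f t" "?f (?f t) = ?f t" for t
    using assms attach_less[of "t mod (2 * d)" d g] by (simp_all add: attach_label_def)
  have pred: "block_sum m ?f a (?f t) = ?c" for t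
  proof -
    have "block_sum m ?f a (?f t) = (\<Sum>s | s < m \<and> ?f s = ?f t. if s = ?f t then ?c else 0)"
      unfolding block_sum_def
    proof (intro sum.cong refl)
      fix s assume s: "s \<in> {s. s < m \<and> ?f s = ?f t}"
      have "s < 2 * d \<and> attach d g s = s \<longleftrightarrow> s = ?f t"
        using s f[of t] by (auto simp: attach_label_def)
      then show "a $ s = (if s = ?f t then ?c else 0)"
        using s by (simp add: a_def)
    qed
    also have "\<dots> = ?c" using f[of t] assms(2) by simp
    finally show ?thesis .
  qed
  have row: "(\<Sum>j<m. ?K $$ (i, j) * a $ j) = ?c" if "i < m" for i
  proof -
    have "(\<Sum>j<m. ?K $$ (i, j) * a $ j) = (\<Sum>j<m. if ?f j = ?f i then a $ j else 0)"
      using that by (intro sum.cong) auto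
    also have "\<dots> = block_sum m ?f a (?f i)"
      unfolding block_sum_def by (subst sum.inter_filter[symmetric]) (auto intro!: sum.cong)
    finally show ?thesis using pred by simp
  qed
  have "a \<bullet> (?K *\<^sub>v a) = (\<Sum>i<m. a $ i * ?c)"
    unfolding quadratic_form_eq[OF label_kernel_carrier am] by (intro sum.cong refl) (simp only: row lessThan_iff)
  also have "\<dots> = (\<Sum>i<m. if i < 2 * d \<and> attach d g i = i then ?c * ?c else 0)"
    by (intro sum.cong) (auto simp: a_def)
  also have "\<dots> \<le> (\<Sum>i<m. if i \<in> {..<2 * d} then ?c * ?c else 0)"
    by (intro sum_mono) auto
  also have "\<dots> = (\<Sum>i\<in>{..<m} \<inter> {..<2 * d}. ?c * ?c)"
    by (rule sum.inter_restrict[symmetric]) simp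
  also have "\<dots> = 2" using assms by (simp add: Int_absorb1)
  finally have "a \<in> feasible m ?K" using am by (simp add: feasible_def)
  then have "min_loss m ?K (vec m (\<lambda>_. ?c)) \<le> avg_loss m ?K (vec m (\<lambda>_. ?c)) a"
    by (rule min_loss_le_avg_loss)
  also have "\<dots> = 0" by (simp add: avg_loss_label_kernel[OF am] pred)
  finally show ?thesis .
qed

section \<open>From indices to groups\<close>

lemma sum_mod_periods:
  fixes F :: "nat \<Rightarrow> real"
  shows "(\<Sum>t<n * k. F (t mod k)) = real n * (\<Sum>b<k. F b)"
proof -
  have "(\<Sum>t = i * k..<i * k + k. F (t mod k)) = (\<Sum>b<k. F b)" for i
    using sum.shift_bounds_nat_ivl[of "\<lambda>t. F (t mod k)" 0 "i * k" k]
    by (simp add: add.commute atLeast0LessThan)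
  then show ?thesis by (simp flip: sum.nat_group)
qed

text \<open>Every group has at least \<open>n = m div (2 * d)\<close> indices. The incomplete last
  period, which is dropped, has at most \<open>2 * d \<le> m / 64\<close> of them, so
  \<open>2 * d * n \<ge> 63 / 64 * m\<close>.\<close>

lemma group_loss_le_avg_loss:
  fixes c :: real
  assumes "d \<ge> 1" "m \<ge> 2 ^ 7 * d" "a \<in> carrier_vec m"
  shows "63 / (128 * real d) * (\<Sum>b<2 * d. \<bar>block_sum m (attach_label d g) a (attach d g b) - c\<bar>)
    \<le> avg_loss m (label_kernel m (attach_label d g)) (vec m (\<lambda>_. c)) a"
proof -
  define D where "D b = \<bar>block_sum m (attach_label d g) a (attach d g b) - c\<bar>" for b
  define n where "n = m div (2 * d)"
  have "m mod (2 * d) \<le> 2 * d" using assms(1) by simp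
  then have "m \<le> 2 * d * n + 2 * d"
    using mult_div_mod_eq[of "2 * d" m] unfolding n_def by linarith
  then have "real m \<le> real (2 * d * n + 2 * d)" by (simp only: of_nat_le_iff)
  then have "real m \<le> 2 * real d * real n + 2 * real d" by simp
  moreover have "128 * real d \<le> real m"
    using of_nat_mono[OF assms(2), where 'a = real] by simp
  ultimately have n: "63 * real m \<le> 128 * real d * real n" by simp
  have "m > 0" using assms(1,2) by simp
  have "real n * (\<Sum>b<2 * d. D b) = (\<Sum>t<n * (2 * d). D (t mod (2 * d)))"
    by (rule sum_mod_periods[symmetric])
  also have "\<dots> \<le> (\<Sum>t<m. D (t mod (2 * d)))"
    using div_times_less_eq_dividend[of m "2 * d"]
    by (intro sum_mono2) (auto simp: n_def D_def)
  finally have "1 / real m * (real n * (\<Sum>b<2 * d. D b)) \<le> 1 / real m * (\<Sum>t<m. D (t mod (2 * d)))"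
    by (intro mult_left_mono) auto
  also have "\<dots> = avg_loss m (label_kernel m (attach_label d g)) (vec m (\<lambda>_. c)) a"
    using assms(3) by (simp add: avg_loss_label_kernel D_def attach_label_def)
  finally have *: "1 / real m * (real n * (\<Sum>b<2 * d. D b)) \<le> \<dots>" .
  have "63 / (128 * real d) \<le> real n / real m"
    using n assms(1) \<open>m > 0\<close> by (simp add: divide_simps mult_ac)
  then have "63 / (128 * real d) * (\<Sum>b<2 * d. D b) \<le> real n / real m * (\<Sum>b<2 * d. D b)"
    by (intro mult_right_mono sum_nonneg) (auto simp: D_def)
  with * show ?thesis by (simp add: D_def)
qed

section \<open>The bound for a deterministic strategy, averaged over the merges\<close>

text \<open>Resampling \<open>g i\<close> for a single group \<open>i \<ge> d\<close> gives
  \<open>local\<close>; averaging this over \<open>g\<close> and summing over the \<open>d\<close>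
  choices of \<open>i\<close> gives the bound.\<close>

lemma sum_group_loss_ge:
  fixes d m B :: nat and c :: real and S :: strategy
  defines "G \<equiv> PiE {d..<2 * d} (\<lambda>_. {..<2 * d})"
    and "\<alpha> \<equiv> \<lambda>g. returned S (label_kernel m (attach_label d g))"
  assumes d: "d \<ge> 1" and c: "c \<ge> 0"
    and Q: "\<And>g. queried S (label_kernel m (attach_label d g)) \<subseteq> {..<m} \<times> {..<m}"
    and B: "\<And>g. card (queried S (label_kernel m (attach_label d g))) \<le> B"
  shows "real (card G) * (c * real d / 2 - 2 * real B * c / real d) \<le>
    (\<Sum>g\<in>G. \<Sum>b<2 * d. \<bar>block_sum m (attach_label d g) (\<alpha> g) (attach d g b) - c\<bar>)"
proof -
  define K where "K g = label_kernel m (attach_label d g)" for g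
  define D where "D g b = \<bar>block_sum m (attach_label d g) (\<alpha> g) (attach d g b) - c\<bar>" for g b
  \<comment> \<open>Only queries with an endpoint in the group \<open>i\<close> can tell with which
    block it is merged.\<close>
  define Qs where "Qs g i = {p \<in> queried S (K g). fst p mod (2 * d) = i \<or> snd p mod (2 * d) = i}"
    for g i
  have finQ: "finite (queried S (K g))" for g
    using finite_subset[OF Q[of g]] by (simp add: K_def)
  have alone: "D (g(i := x)) = D (g(i := d))" "Qs (g(i := x)) i = Qs (g(i := d)) i"
    if "d \<le> x" for g i x
  proof -
    have "attach_label d (g(i := x)) = attach_label d (g(i := d))"
      unfolding attach_label_def[abs_def] attach_update_alone[OF that] ..
    then show "D (g(i := x)) = D (g(i := d))" "Qs (g(i := x)) i = Qs (g(i := d)) i"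
      unfolding D_def[abs_def] Qs_def K_def \<alpha>_def attach_update_alone[OF that]
      by (simp_all only:)
  qed
  \<comment> \<open>The values \<open>x < d\<close> merge the group \<open>i\<close>, the other
    \<open>d\<close> values leave it alone. The weight \<open>1 / d\<close> makes each group
    \<open>j < d\<close> count exactly once after summing over all \<open>i\<close>; the last term
    pays for detected merges.\<close>
  have local: "c * d \<le> (\<Sum>x<2 * d. D (g(i := x)) i + (\<Sum>j<d. D (g(i := x)) j) / d
      + c / d * card (Qs (g(i := x)) i))"
    if i: "i \<in> {d..<2 * d}" for g i
  proof -
    let ?g = "g(i := d)"
    let ?f = "attach_label d ?g"
    have di: "d \<le> i" using i by simp
    define Det where "Det = {j. j < d \<and> (\<exists>(s, t)\<in>queried S (K ?g). K (g(i := j)) $$ (s, t) \<noteq> K ?g $$ (s, t))}"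
    \<comment> \<open>A query reveals at most one \<open>j\<close>, the label of its endpoint
      outside the group \<open>i\<close>; with both endpoints in that group it reveals
      nothing.\<close>
    have "Det \<subseteq> (\<lambda>(s, t). if s mod (2 * d) = i then ?f t else ?f s) ` Qs ?g i"
    proof
      fix j assume "j \<in> Det"
      then obtain s t where j: "j < d" and st: "(s, t) \<in> queried S (K ?g)"
        and ne: "K (g(i := j)) $$ (s, t) \<noteq> K ?g $$ (s, t)"
        unfolding Det_def by auto
      have "s < m" "t < m" using st Q[of ?g] by (auto simp: K_def)
      then have "(attach_label d (g(i := j)) s = attach_label d (g(i := j)) t) \<noteq> (?f s = ?f t)"
        using ne by (auto simp: K_def split: if_splits)
      then have "(s mod (2 * d) = i \<and> ?f t = j) \<or>
          (s mod (2 * d) \<noteq> i \<and> t mod (2 * d) = i \<and> ?f s = j)"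
        using attach_label_update(1)[OF di] attach_label_update(2)[OF di j] by metis
      then show "j \<in> (\<lambda>(s, t). if s mod (2 * d) = i then ?f t else ?f s) ` Qs ?g i"
        using st by (auto simp: Qs_def image_iff intro!: bexI[of _ "(s, t)"])
    qed
    moreover have "finite (Qs ?g i)" using finQ by (simp add: Qs_def)
    ultimately have card_Det: "card Det \<le> card (Qs ?g i)" by (intro surj_card_le)
    \<comment> \<open>With \<open>w\<close> and \<open>v\<close> for the block sums of
      \<open>i\<close> and \<open>j\<close> under \<open>?g\<close>, the merged block has sum
      \<open>v + w\<close>, and \<open>c = (v + w - c) - (w - c) - (v - c)\<close>.\<close>
    have undetected: "c \<le> D ?g i + D ?g j + D (g(i := j)) i" if j: "j < d" "j \<notin> Det" for j
    proof -
      have "\<alpha> (g(i := j)) = \<alpha> ?g"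
        unfolding \<alpha>_def using j
        by (intro returned_eq_if_agree_on_queried) (auto simp: Det_def K_def)
      then show ?thesis
        using block_sum_attach[OF di j(1), of m g "\<alpha> ?g"] di j(1)
        by (simp add: D_def attach_def)
    qed
    have D0: "D h b \<ge> 0" for h b by (simp add: D_def)
    have "c * real d - c * card (Qs ?g i) \<le> c * (real d - card Det)"
      using card_Det c by (simp add: right_diff_distrib mult_left_mono)
    also have "\<dots> = (\<Sum>j<d. c) - (\<Sum>j\<in>Det. c)"
      by (simp add: algebra_simps)
    also have "\<dots> = (\<Sum>j\<in>{..<d} - Det. c)"
      by (intro sum_diff[symmetric]) (auto simp: Det_def)
    also have "\<dots> \<le> (\<Sum>j\<in>{..<d} - Det. D ?g i + D ?g j + D (g(i := j)) i)"
      by (intro sum_mono) (auto intro: undetected)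
    also have "\<dots> \<le> (\<Sum>j<d. D ?g i + D ?g j + D (g(i := j)) i)"
      by (intro sum_mono2) (auto simp: D0)
    finally have main: "c * real d - c * card (Qs ?g i) \<le>
        d * D ?g i + (\<Sum>j<d. D ?g j) + (\<Sum>j<d. D (g(i := j)) i)"
      by (simp add: sum.distrib)
    let ?F = "\<lambda>x. D (g(i := x)) i + (\<Sum>j<d. D (g(i := x)) j) / d + c / d * card (Qs (g(i := x)) i)"
    have "(\<Sum>x<2 * d. ?F x) = (\<Sum>x<d. ?F x) + (\<Sum>x\<in>{d..<2 * d}. ?F x)"
      by (subst sum.union_disjoint[symmetric]) (auto intro!: sum.cong)
    \<comment> \<open>All \<open>d\<close> values that leave the group alone act alike; their number
      cancels the denominators \<open>d\<close>.\<close>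
    moreover have "(\<Sum>x\<in>{d..<2 * d}. ?F x) = (\<Sum>x\<in>{d..<2 * d}. ?F d)"
    proof (intro sum.cong refl)
      fix x assume "x \<in> {d..<2 * d}"
      then have "d \<le> x" by simp
      then show "?F x = ?F d" by (simp only: alone[of x])
    qed
    moreover have "\<dots> = d * D ?g i + (\<Sum>j<d. D ?g j) + c * card (Qs ?g i)"
      using d by (simp add: field_simps)
    \<comment> \<open>For the merged outcomes only the error of the group \<open>i\<close> itself is
      kept.\<close>
    moreover have "(\<Sum>j<d. D (g(i := j)) i) \<le> (\<Sum>x<d. ?F x)"
      using c by (intro sum_mono) (simp add: D0 sum_nonneg)
    ultimately show ?thesis using main by linarith
  qed
  have per_group: "card G * c / 2 \<le> (\<Sum>g\<in>G. D g i + (\<Sum>j<d. D g j) / d + c / d * card (Qs g i))"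
    (is "_ \<le> ?R") if i: "i \<in> {d..<2 * d}" for i
  proof -
    \<comment> \<open>The bound \<open>c * d\<close> is shared among \<open>2 * d\<close> resampled
      values, hence \<open>c / 2\<close>.\<close>
    have "(\<Sum>g\<in>G. c * d) \<le> real (card {..<2 * d}) * ?R"
      unfolding G_def using local[OF i]
      by (subst sum_PiE_update[OF i, symmetric]) (intro sum_mono)
    then have "real d * (card G * c) \<le> real d * (2 * ?R)" by (simp add: mult_ac)
    then show ?thesis using d by simp
  qed
  \<comment> \<open>A query has one row group and one column group, so it is counted at most
    twice.\<close>
  have queries: "(\<Sum>i\<in>{d..<2 * d}. card (Qs g i)) \<le> 2 * B" for g
  proof -
    let ?Q = "queried S (K g)"
    have "(\<Sum>i\<in>{d..<2 * d}. card (Qs g i)) \<le>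
        (\<Sum>i\<in>{d..<2 * d}. card {p \<in> ?Q. fst p mod (2 * d) = i} + card {p \<in> ?Q. snd p mod (2 * d) = i})"
    proof (intro sum_mono)
      fix i
      have "Qs g i = {p \<in> ?Q. fst p mod (2 * d) = i} \<union> {p \<in> ?Q. snd p mod (2 * d) = i}"
        by (auto simp: Qs_def)
      then show "card (Qs g i) \<le> card {p \<in> ?Q. fst p mod (2 * d) = i} + card {p \<in> ?Q. snd p mod (2 * d) = i}"
        by (simp add: card_Un_le)
    qed
    also have "\<dots> \<le> card ?Q + card ?Q"
      unfolding sum.distrib using finQ by (intro add_mono sum_card_fibres_le) auto
    also have "\<dots> \<le> 2 * B" using B[of g] by (simp add: K_def)
    finally show ?thesis .
  qed
  have "d * (card G * c / 2) \<le>
      (\<Sum>i\<in>{d..<2 * d}. \<Sum>g\<in>G. D g i + (\<Sum>j<d. D g j) / d + c / d * card (Qs g i))"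
    using sum_mono[of "{d..<2 * d}", OF per_group] by simp
  also have "\<dots> = (\<Sum>g\<in>G. \<Sum>i\<in>{d..<2 * d}. D g i + (\<Sum>j<d. D g j) / d + c / d * card (Qs g i))"
    by (rule sum.swap)
  also have "\<dots> \<le> (\<Sum>g\<in>G. (\<Sum>b<2 * d. D g b) + c / d * (2 * B))"
  proof (intro sum_mono)
    fix g
    have "(\<Sum>b<2 * d. D g b) = (\<Sum>b<d. D g b) + (\<Sum>b\<in>{d..<2 * d}. D g b)"
      by (subst sum.union_disjoint[symmetric]) (auto intro!: sum.cong)
    moreover have "c / d * (\<Sum>i\<in>{d..<2 * d}. real (card (Qs g i))) \<le> c / d * (2 * B)"
      using queries[of g] c by (intro mult_left_mono) (simp_all flip: of_nat_sum)
    moreover have "(\<Sum>i\<in>{d..<2 * d}. D g i + (\<Sum>j<d. D g j) / d + c / d * card (Qs g i)) =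
        (\<Sum>b\<in>{d..<2 * d}. D g b) + (\<Sum>b<d. D g b) + c / d * (\<Sum>i\<in>{d..<2 * d}. real (card (Qs g i)))"
      unfolding sum.distrib sum_distrib_left[symmetric] using d by simp
    ultimately show "(\<Sum>i\<in>{d..<2 * d}. D g i + (\<Sum>j<d. D g j) / d + c / d * card (Qs g i)) \<le>
        (\<Sum>b<2 * d. D g b) + c / d * (2 * B)"
      by linarith
  qed
  also have "\<dots> = (\<Sum>g\<in>G. \<Sum>b<2 * d. D g b) + card G * (2 * B * c / d)"
    by (simp add: sum.distrib mult_ac)
  finally have "d * (card G * c / 2) - card G * (2 * B * c / d) \<le> (\<Sum>g\<in>G. \<Sum>b<2 * d. D g b)"
    by linarith
  moreover have "card G * (c * real d / 2 - 2 * real B * c / real d) =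
      d * (card G * c / 2) - card G * (2 * B * c / d)"
    by (simp add: right_diff_distrib)
  ultimately show ?thesis unfolding D_def by (simp only:)
qed

section \<open>Averaging over the merges and over the internal randomness\<close>

theorem theorem1:
  fixes d m B :: nat
    and M :: "'w measure"
    and A :: "'w \<Rightarrow> real vec \<Rightarrow> strategy"
  assumes "d \<ge> 1"
    and "m \<ge> 2 ^ 7 * d"
    and "real B < 3 / 50 * (real d)\<^sup>2"
    and "budgeted_algorithm (kernel_class (2 * d) m) m B M A"
  shows "\<exists>K\<in>kernel_class (2 * d) m. \<exists>y\<in>targets m.
    expected_loss m M A K y - ereal (min_loss m K y) \<ge> ereal (1 / (70 * sqrt (real d)))"
proof -
  define c where "c = 1 / sqrt (real d)"
  define y where "y = vec m (\<lambda>_. c)"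
  define K where "K g = label_kernel m (attach_label d g)" for g
  define G where "G = PiE {d..<2 * d} (\<lambda>_. {..<2 * d})"
  define l where "l g \<omega> = avg_loss m (K g) y (returned (A \<omega> y) (K g))" for g \<omega>
  have c: "0 \<le> c" "c \<le> 1" using assms(1) by (simp_all add: c_def)
  have y: "y \<in> targets m" using c by (simp add: y_def targets_def)
  have K: "K g \<in> kernel_class (2 * d) m" for g
    unfolding K_def by (rule attach_kernel_in_kernel_class[OF assms(1)])
  interpret prob_space M using assms(4) by (simp add: budgeted_algorithm_def)
  have alg: "queried (A \<omega> y) (K g) \<subseteq> {..<m} \<times> {..<m}" "card (queried (A \<omega> y) (K g)) \<le> B"
    "returned (A \<omega> y) (K g) \<in> carrier_vec m" if "\<omega> \<in> space M" for \<omega> g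
    using assms(4) that y K[of g] unfolding budgeted_algorithm_def budgeted_def by blast+
  have meas: "(\<lambda>\<omega>. returned (A \<omega> y) (K g) $ i) \<in> borel_measurable M" if "i < m" for i g
    using assms(4) that y K[of g] unfolding budgeted_algorithm_def by blast
  \<comment> \<open>Measurability is given for the entries of the returned vector, so the loss is
    expanded into them.\<close>
  have l_meas [measurable]: "l g \<in> borel_measurable M" for g
  proof -
    have "(\<lambda>\<omega>. 1 / real m * (\<Sum>t<m. \<bar>(\<Sum>s | s < m \<and> attach_label d g s = attach_label d g t.
        returned (A \<omega> y) (K g) $ s) - y $ t\<bar>)) \<in> borel_measurable M"
      using meas by (intro borel_measurable_times borel_measurable_sum borel_measurable_abs
          borel_measurable_diff borel_measurable_const) auto
    then show ?thesis
      by (rule measurable_cong[THEN iffD2, rotated])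
        (simp add: l_def K_def avg_loss_label_kernel alg(3)[unfolded K_def] block_sum_def)
  qed
  have "finite G" by (simp add: G_def finite_PiE)
  have "G \<noteq> {}" using assms(1) by (auto simp: G_def PiE_eq_empty_iff)
  have l0: "l g \<omega> \<ge> 0" for g \<omega> by (simp add: l_def avg_loss_nonneg)
  have sum_l: "card G * (c / 70) \<le> (\<Sum>g\<in>G. l g \<omega>)" if \<omega>: "\<omega> \<in> space M" for \<omega>
  proof -
    \<comment> \<open>The budget costs at most \<open>6 / 50\<close> of \<open>c * d\<close> out of
      the available \<open>1 / 2\<close>, which leaves \<open>19 / 50\<close>. Then
      \<open>63 / 128 * 19 / 50 = 1197 / 6400\<close>, well above \<open>1 / 70\<close>.\<close>
    have "real B * c \<le> 3 / 50 * (real d)\<^sup>2 * c"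
      using assms(3) c by (intro mult_right_mono) auto
    then have "19 / 50 * (c * d) \<le> c * real d / 2 - 2 * real B * c / real d"
      using assms(1) by (simp add: field_simps power2_eq_square)
    then have "63 / (128 * d) * (card G * (19 / 50 * (c * d))) \<le>
        63 / (128 * d) * (card G * (c * real d / 2 - 2 * real B * c / real d))"
      by (intro mult_left_mono) auto
    also have "\<dots> \<le> 63 / (128 * d) * (\<Sum>g\<in>G. \<Sum>b<2 * d.
        \<bar>block_sum m (attach_label d g) (returned (A \<omega> y) (K g)) (attach d g b) - c\<bar>)"
      unfolding G_def K_def using alg(1,2)[OF \<omega>] assms(1) c
      by (intro mult_left_mono sum_group_loss_ge) (auto simp: K_def)
    also have "\<dots> \<le> (\<Sum>g\<in>G. l g \<omega>)"
      unfolding sum_distrib_left[of _ _ G] l_def K_def y_def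
      using group_loss_le_avg_loss[OF assms(1,2)] alg(3)[OF \<omega>]
      by (intro sum_mono) (simp add: K_def y_def)
    finally have "card G * (1197 / 6400 * c) \<le> (\<Sum>g\<in>G. l g \<omega>)"
      using assms(1) by (simp add: field_simps)
    moreover have "card G * (c / 70) \<le> card G * (1197 / 6400 * c)"
      using c by (intro mult_left_mono) auto
    ultimately show ?thesis by linarith
  qed
  \<comment> \<open>Integrating \<open>sum_l\<close> bounds the sum of the expected losses over
    \<open>G\<close> from below, so they cannot all be smaller than \<open>c / 70\<close>.\<close>
  have "\<exists>g\<in>G. ennreal (c / 70) \<le> (\<integral>\<^sup>+\<omega>. ennreal (l g \<omega>) \<partial>M)"
  proof (rule ccontr)
    \<comment> \<open>Under the contrary assumption the integrals are finite, so
      \<open>enn2real\<close> loses nothing and the strict inequalities can be summed over the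
      reals.\<close>
    define r where "r g = enn2real (\<integral>\<^sup>+\<omega>. ennreal (l g \<omega>) \<partial>M)" for g
    assume "\<not> ?thesis"
    then have less: "(\<integral>\<^sup>+\<omega>. ennreal (l g \<omega>) \<partial>M) < ennreal (c / 70)" if "g \<in> G" for g
      using that by (auto simp: not_le)
    have r: "(\<integral>\<^sup>+\<omega>. ennreal (l g \<omega>) \<partial>M) = ennreal (r g)" if "g \<in> G" for g
      using order_less_trans[OF less[OF that] ennreal_less_top] by (simp add: r_def)
    have r0: "r g \<ge> 0" for g by (simp add: r_def)
    have "r g < c / 70" if "g \<in> G" for g
      using less[OF that] unfolding r[OF that] by (simp add: ennreal_less_iff r0)
    then have "(\<Sum>g\<in>G. r g) < (\<Sum>g\<in>G. c / 70)"
      using \<open>finite G\<close> \<open>G \<noteq> {}\<close> by (intro sum_strict_mono)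
    moreover have "ennreal (\<Sum>g\<in>G. c / 70) \<le> ennreal (\<Sum>g\<in>G. r g)"
    proof -
      have "ennreal (\<Sum>g\<in>G. c / 70) = (\<integral>\<^sup>+\<omega>. ennreal (card G * (c / 70)) \<partial>M)"
        by (simp add: emeasure_space_1)
      also have "\<dots> \<le> (\<integral>\<^sup>+\<omega>. (\<Sum>g\<in>G. ennreal (l g \<omega>)) \<partial>M)"
        using sum_l by (intro nn_integral_mono) (auto simp: l0 intro!: ennreal_leI)
      also have "\<dots> = (\<Sum>g\<in>G. \<integral>\<^sup>+\<omega>. ennreal (l g \<omega>) \<partial>M)"
        by (intro nn_integral_sum) auto
      also have "\<dots> = ennreal (\<Sum>g\<in>G. r g)"
        by (simp add: r r0)
      finally show ?thesis .
    qed
    moreover have "(\<Sum>g\<in>G. r g) \<ge> 0" by (simp add: r0 sum_nonneg)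
    ultimately show False by simp
  qed
  then obtain g where g: "ennreal (c / 70) \<le> (\<integral>\<^sup>+\<omega>. ennreal (l g \<omega>) \<partial>M)" by blast
  have "ereal (c / 70) = enn2ereal (ennreal (c / 70))" using c by simp
  also have "\<dots> \<le> expected_loss m M A (K g) y"
    using g unfolding expected_loss_def l_def by (simp only: less_eq_ennreal.rep_eq)
  finally have "ereal (c / 70) \<le> expected_loss m M A (K g) y" .
  moreover have "min_loss m (K g) y \<le> 0"
    using min_loss_attach_kernel_le_0[OF assms(1), of m g] assms(2) by (simp add: K_def y_def c_def)
  \<comment> \<open>The expected loss may be infinite, hence the case distinction.\<close>
  ultimately have "ereal (c / 70) \<le> expected_loss m M A (K g) y - ereal (min_loss m (K g) y)"
    by (cases "expected_loss m M A (K g) y") auto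
  then show ?thesis
    using K[of g] y by (intro bexI[of _ "K g"] bexI[of _ y]) (simp_all add: c_def mult.commute)
qed

end
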